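(* Suppose that matrices $A$ and $B$ in $M_2(\mathbb R)$ satisfy $AB\ge BA\ge 0$. Then $AB-BA$ is in the radical of the Banach algebra generated by $A$ and $B$.
   Context: Inequalities between real matrices are entrywise. The Banach algebra generated by $A$ and $B$ is the (closed) subalgebra of $M_2(\mathbb R)$ generated by $A$ and $B$. The radical of a Banach algebra $\mathcal A$ is the intersection of all maximal modular left ideals of $\mathcal A$ (equivalently, of all maximal modular right ideals); if $\mathcal A$ is unital it equals $\{a\in\mathcal A: r(ba)=0 \text{ for all } b\in\mathcal A\}=\{a\in\mathcal A: r(ab)=0 \text{ for all } b\in\mathcal A\}$, where $r$ is the spectral radius. For a non-unital algebra, spectra are computed in the standard unitization. *)

theory Defs
  imports "HOL-Analysis.Analysis"
begin

definition closed_subalgebra :: "(real^'n^'n) set \<Rightarrow> bool" where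
  "closed_subalgebra S \<longleftrightarrow>
     subspace S \<and> closed S \<and> (\<forall>X\<in>S. \<forall>Y\<in>S. X ** Y \<in> S)"

(* Not required to contain the identity matrix. *)
definition generated_banach_algebra :: "(real^'n^'n) set \<Rightarrow> (real^'n^'n) set" where
  "generated_banach_algebra G = closed_subalgebra hull G"

definition left_ideal_of :: "(real^'n^'n) set \<Rightarrow> (real^'n^'n) set \<Rightarrow> bool" where
  "left_ideal_of S L \<longleftrightarrow>
     subspace L \<and> L \<subseteq> S \<and> (\<forall>X\<in>S. \<forall>Y\<in>L. X ** Y \<in> L)"

definition modular_left_ideal_of :: "(real^'n^'n) set \<Rightarrow> (real^'n^'n) set \<Rightarrow> bool" where
  "modular_left_ideal_of S L \<longleftrightarrow>
     left_ideal_of S L \<and> (\<exists>U\<in>S. \<forall>X\<in>S. X - X ** U \<in> L)"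

definition maximal_modular_left_ideal_of ::
    "(real^'n^'n) set \<Rightarrow> (real^'n^'n) set \<Rightarrow> bool" where
  "maximal_modular_left_ideal_of S L \<longleftrightarrow>
     modular_left_ideal_of S L \<and> L \<noteq> S \<and>
     (\<forall>J. left_ideal_of S J \<and> L \<subseteq> J \<longrightarrow> J = L \<or> J = S)"

(* The intersection is taken inside S, so the radical is S itself
   if S has no maximal modular left ideals. *)
definition banach_radical :: "(real^'n^'n) set \<Rightarrow> (real^'n^'n) set" where
  "banach_radical S = S \<inter> \<Inter>{L. maximal_modular_left_ideal_of S L}"

end

theory Submission
  imports Defs
begin

text \<open>
  Write \<open>C = A ** B - B ** A\<close>. Since \<open>A ** B\<close> and \<open>B ** A\<close> have equal traces and \<open>C \<ge> 0\<close>, the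
  diagonal of \<open>C\<close> vanishes. They also have equal determinants; because \<open>B ** A \<ge> 0\<close>, raising both
  off-diagonal entries of \<open>B ** A\<close> would change the determinant, so at most one off-diagonal entry of
  \<open>C\<close> is nonzero (\<open>commutator_entries_2\<close>). Hence \<open>C\<close> is a multiple of a nilpotent matrix unit, and
  since \<open>A ** C\<close> and \<open>B ** C\<close> have trace zero by cyclicity of the trace, the matrices \<open>A\<close> and \<open>B\<close>
  are triangular in the same sense as \<open>C\<close>, unless \<open>C = 0\<close>.

  Triangularity enters only through its consequence that \<open>A ** C\<close> and \<open>B ** C\<close> are scalar multiples
  of \<open>C\<close>. The matrices with this property form a closed algebra, so \<open>C\<close> spans a left ideal of the
  algebra generated by \<open>A\<close> and \<open>B\<close>. This left ideal squares to zero, and such an ideal lies in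
  every maximal modular left ideal (\<open>square_zero_eigenvector_in_banach_radical\<close>).
\<close>

lemma bilinear_matrix_matrix_mult:
  "bilinear ((**) :: real^'m^'n \<Rightarrow> real^'k^'m \<Rightarrow> real^'k^'n)"
  unfolding bilinear_def
  by (auto intro!: linearI simp: vec_eq_iff matrix_matrix_mult_def algebra_simps sum.distrib
      sum_distrib_left)

lemmas matrix_mult_bilinear_simps =
  bilinear_ladd[OF bilinear_matrix_matrix_mult] bilinear_radd[OF bilinear_matrix_matrix_mult]
  bilinear_lmul[OF bilinear_matrix_matrix_mult] bilinear_rmul[OF bilinear_matrix_matrix_mult]
  bilinear_rsub[OF bilinear_matrix_matrix_mult]
  bilinear_lzero[OF bilinear_matrix_matrix_mult]

lemma closed_subalgebra_generated_banach_algebra: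
  "closed_subalgebra (generated_banach_algebra G)"
  unfolding generated_banach_algebra_def
proof (rule hull_in)
  fix T :: "(real^'n^'n) set set"
  assume "\<forall>S\<in>T. closed_subalgebra S"
  then show "closed_subalgebra (\<Inter>T)"
    unfolding closed_subalgebra_def by (auto intro!: subspace_Inter closed_Inter)
qed

lemma closed_subalgebra_common_eigenvector:
  fixes C :: "real^'n^'n"
  shows "closed_subalgebra {X. \<exists>k. X ** C = k *\<^sub>R C}" (is "closed_subalgebra ?T")
  unfolding closed_subalgebra_def
proof (intro conjI ballI)
  show sub: "subspace ?T"
  proof (rule subspaceI)
    show "0 \<in> ?T"
      by (auto intro!: exI[of _ 0] simp: matrix_mult_bilinear_simps)
    show "X + Y \<in> ?T" if "X \<in> ?T" "Y \<in> ?T" for X Y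
      using that by (auto simp: matrix_mult_bilinear_simps simp flip: scaleR_add_left)
    show "c *\<^sub>R X \<in> ?T" if "X \<in> ?T" for c X
      using that by (auto simp: matrix_mult_bilinear_simps)
  qed
  show "closed ?T"
    using sub by (rule closed_subspace)
  show "X ** Y \<in> ?T" if "X \<in> ?T" "Y \<in> ?T" for X Y
    using that by (auto simp: matrix_mult_bilinear_simps simp flip: matrix_mul_assoc)
qed

text \<open>
  If \<open>C\<close> were outside a maximal modular left ideal \<open>L\<close>, then \<open>L\<close> and the left ideal spanned by \<open>C\<close>
  would together give all of \<open>S\<close>, so a right identity modulo \<open>L\<close> could be written as
  \<open>l + t *\<^sub>R C\<close>. As \<open>C ** C = 0\<close>, multiplying it by \<open>C\<close> from the left leaves \<open>C ** l \<in> L\<close>, and this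
  is congruent to \<open>C\<close> modulo \<open>L\<close>.
\<close>

lemma square_zero_eigenvector_in_banach_radical:
  fixes C :: "real^'n^'n"
  assumes C: "C \<in> S" and S: "subspace S"
    and eigen: "\<And>X. X \<in> S \<Longrightarrow> \<exists>k. X ** C = k *\<^sub>R C"
    and square: "C ** C = 0"
  shows "C \<in> banach_radical S"
proof -
  have "C \<in> L" if max: "maximal_modular_left_ideal_of S L" for L
  proof (rule ccontr)
    assume notin: "C \<notin> L"
    have L: "subspace L" "L \<subseteq> S" and ideal: "\<And>X Y. X \<in> S \<Longrightarrow> Y \<in> L \<Longrightarrow> X ** Y \<in> L"
      using max unfolding maximal_modular_left_ideal_of_def modular_left_ideal_of_def
        left_ideal_of_def by auto
    obtain U where U: "U \<in> S" "\<And>X. X \<in> S \<Longrightarrow> X - X ** U \<in> L"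
      using max unfolding maximal_modular_left_ideal_of_def modular_left_ideal_of_def by auto
    define J where "J = {l + c | l c. l \<in> L \<and> c \<in> span {C}}"
    have "left_ideal_of S J"
      unfolding left_ideal_of_def
    proof (intro conjI ballI)
      show "subspace J"
        unfolding J_def using L(1) by (intro subspace_sums) auto
      show "J \<subseteq> S"
        using L C S by (auto simp: J_def span_singleton intro!: subspace_add subspace_scale)
      show "X ** Y \<in> J" if X: "X \<in> S" and "Y \<in> J" for X Y
      proof -
        obtain l t where l: "l \<in> L" and Y: "Y = l + t *\<^sub>R C"
          using \<open>Y \<in> J\<close> by (auto simp: J_def span_singleton)
        obtain k where k: "X ** C = k *\<^sub>R C"
          using eigen[OF X] by auto
        have "X ** Y = X ** l + (t * k) *\<^sub>R C"
          by (simp add: Y matrix_mult_bilinear_simps k)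
        then show ?thesis
          using ideal[OF X l] by (auto simp: J_def span_singleton)
      qed
    qed
    moreover have "L \<subseteq> J"
      using span_zero by (force simp: J_def)
    moreover have "C \<in> J"
      using subspace_0[OF L(1)] span_base[of C "{C}"] by (force simp: J_def)
    ultimately have "J = S"
      using max notin unfolding maximal_modular_left_ideal_of_def by blast
    then obtain l t where l: "l \<in> L" and "U = l + t *\<^sub>R C"
      using U(1) by (auto simp: J_def span_singleton)
    then have "C ** U = C ** l"
      by (simp add: matrix_mult_bilinear_simps square)
    then have "(C - C ** l) + C ** l \<in> L"
      using U(2)[OF C] ideal[OF C l] subspace_add[OF L(1)] by metis
    with notin show False by simp
  qed
  with C show ?thesis
    by (auto simp: banach_radical_def)
qed

lemma commutator_entries_2:
  fixes A B :: "real^2^2"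
  assumes "A ** B \<ge> B ** A" and "B ** A \<ge> 0"
  defines "C \<equiv> A ** B - B ** A"
  shows "C $ 1 $ 1 = 0" "C $ 2 $ 2 = 0" "C $ 1 $ 2 * C $ 2 $ 1 = 0"
proof -
  define P where "P = B ** A"
  have AB: "A ** B = P + C" by (simp add: C_def P_def)
  have P: "P $ i $ j \<ge> 0" and C: "C $ i $ j \<ge> 0" for i j
    using assms by (auto simp: P_def C_def less_eq_vec_def)
  have "trace (P + C) = trace P"
    using trace_mul_sym[of A B] by (simp add: AB P_def)
  then have "C $ 1 $ 1 + C $ 2 $ 2 = 0"
    by (simp add: trace_def sum_2)
  then show diag: "C $ 1 $ 1 = 0" "C $ 2 $ 2 = 0"
    using C[of 1 1] C[of 2 2] by linarith+
  have "det (P + C) = det P"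
    unfolding AB[symmetric] by (simp add: P_def det_mul)
  then have "P $ 1 $ 2 * C $ 2 $ 1 + C $ 1 $ 2 * P $ 2 $ 1 + C $ 1 $ 2 * C $ 2 $ 1 = 0"
    by (simp add: det_2 diag algebra_simps)
  moreover have "P $ 1 $ 2 * C $ 2 $ 1 \<ge> 0" "C $ 1 $ 2 * P $ 2 $ 1 \<ge> 0"
    "C $ 1 $ 2 * C $ 2 $ 1 \<ge> 0"
    using P C by simp_all
  ultimately show "C $ 1 $ 2 * C $ 2 $ 1 = 0" by linarith
qed

text \<open>
  For \<open>C\<close> a multiple of an off-diagonal matrix unit, the trace of \<open>X ** C\<close> is the same multiple of
  the entry of \<open>X\<close> which has to vanish for \<open>X\<close> to be triangular in the same sense as \<open>C\<close>. Then
  the eigenvalue is a diagonal entry of \<open>X\<close>.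
\<close>

lemma trace_zero_imp_eigenvector_2:
  fixes X C :: "real^2^2"
  assumes C: "C $ 1 $ 1 = 0" "C $ 2 $ 2 = 0" "C $ 1 $ 2 * C $ 2 $ 1 = 0"
    and trace: "trace (X ** C) = 0"
  shows "\<exists>k. X ** C = k *\<^sub>R C"
proof -
  have *: "X $ 1 $ 2 * C $ 2 $ 1 + X $ 2 $ 1 * C $ 1 $ 2 = 0"
    using trace C(1,2) by (simp add: trace_def matrix_matrix_mult_def sum_2)
  consider "C $ 1 $ 2 = 0" | "C $ 2 $ 1 = 0" using C(3) by auto
  then show ?thesis
  proof cases
    case 1
    then have "X ** C = X $ 2 $ 2 *\<^sub>R C"
      using C(1,2) * by (simp add: vec_eq_iff forall_2 matrix_matrix_mult_def sum_2)
    then show ?thesis ..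
  next
    case 2
    then have "X ** C = X $ 1 $ 1 *\<^sub>R C"
      using C(1,2) * by (simp add: vec_eq_iff forall_2 matrix_matrix_mult_def sum_2)
    then show ?thesis ..
  qed
qed

(* The order on real^2^2 is the entrywise one. *)
theorem corollary4p2:
  fixes A B :: "real^2^2"
  assumes "A ** B \<ge> B ** A" and "B ** A \<ge> 0"
  shows "A ** B - B ** A \<in> banach_radical (generated_banach_algebra {A, B})"
proof -
  define C where "C = A ** B - B ** A"
  define S where "S = generated_banach_algebra {A, B}"
  note entries = commutator_entries_2[OF assms, folded C_def]
  have gen: "A \<in> S" "B \<in> S"
    using hull_subset[of "{A, B}" closed_subalgebra]
    by (auto simp: S_def generated_banach_algebra_def)
  have alg: "subspace S" "\<And>X Y. X \<in> S \<Longrightarrow> Y \<in> S \<Longrightarrow> X ** Y \<in> S"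
    using closed_subalgebra_generated_banach_algebra[of "{A, B}"]
    by (auto simp: S_def closed_subalgebra_def)
  have "C \<in> S"
    using gen alg by (auto simp: C_def intro!: subspace_diff)
  moreover have "\<exists>k. X ** C = k *\<^sub>R C" if "X \<in> S" for X
  proof -
    have "trace (A ** C) = 0"
      using trace_mul_sym[of A "A ** B"]
      by (simp add: C_def matrix_mult_bilinear_simps trace_sub matrix_mul_assoc)
    moreover have "trace (B ** C) = 0"
      using trace_mul_sym[of B "B ** A"]
      by (simp add: C_def matrix_mult_bilinear_simps trace_sub matrix_mul_assoc)
    ultimately have "{A, B} \<subseteq> {X. \<exists>k. X ** C = k *\<^sub>R C}"
      using trace_zero_imp_eigenvector_2[OF entries] by auto
    then have "S \<subseteq> {X. \<exists>k. X ** C = k *\<^sub>R C}"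
      unfolding S_def generated_banach_algebra_def
      by (rule hull_minimal) (rule closed_subalgebra_common_eigenvector)
    with that show ?thesis by auto
  qed
  moreover have "C ** C = 0"
    using entries by (auto simp: vec_eq_iff forall_2 matrix_matrix_mult_def sum_2)
  ultimately show ?thesis
    using alg(1) square_zero_eigenvector_in_banach_radical unfolding C_def S_def by blast
qed

end
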